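(* Let $n$ be a positive integer and let $\mathcal{F}\subseteq 2^{[n]}$ be a set system. Then $\mathcal{F}$ is extremal with $\dim_{VC}(\mathcal{F})\leq 2$ and $\emptyset\in\mathcal{F}$ if and only if $\mathcal{F}\in\mathcal{E}$, where $\mathcal{E}$ is the collection of all set systems on $[n]$ that can be obtained from $\{\emptyset\}$ by a finite (possibly empty) sequence of valid applications of Step A and Step B, in any order.
   Context: Notation: $[n]=\{1,\dots,n\}$; $2^S$ is the power set of $S$; $\bigtriangleup$ is symmetric difference; $supp(\mathcal{F})=\bigcup_{F\in\mathcal{F}}F$. A set system $\mathcal{F}\subseteq 2^{[n]}$ shatters $S\subseteq[n]$ if $\{F\cap S : F\in\mathcal{F}\}=2^S$. $Sh(\mathcal{F})$ is the family of all subsets of $[n]$ shattered by $\mathcal{F}$. $\mathcal{F}$ is extremal (shattering-extremal, s-extremal) if $|Sh(\mathcal{F})|=|\mathcal{F}|$. The Vapnik-Chervonenkis dimension $\dim_{VC}(\mathcal{F})$ is the maximum cardinality of a set shattered by $\mathcal{F}$. $\mathcal{F}$ strongly shatters $S\subseteq[n]$ if there exists $I\subseteq[n]\setminus S$ such that $\{H\cup I : H\subseteq S\}\subseteq\mathcal{F}$. $st(\mathcal{F})$ is the family of all subsets of $[n]$ strongly shattered by $\mathcal{F}$. Building steps (each enlarges a given set system $\mathcal{F}\subseteq 2^{[n]}$ by one set): Step A: choose an element $\alpha\in[n]\setminus supp(\mathcal{F})$ and a set $W\in\mathcal{F}$, and replace $\mathcal{F}$ by $\mathcal{F}\cup\{W\cup\{\alpha\}\}$.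 Step B: choose two elements $\alpha,\beta\in supp(\mathcal{F})$ such that $\{\alpha,\beta\}\notin st(\mathcal{F})$, together with sets $P,W,Q\in\mathcal{F}$ such that $Q\bigtriangleup W=\{\alpha\}$ and $P\bigtriangleup W=\{\beta\}$, and replace $\mathcal{F}$ by $\mathcal{F}\cup\{V\}$, where $V=W\bigtriangleup\{\alpha,\beta\}$ (necessarily $V\notin\mathcal{F}$). An application of a step is valid if the stated choices satisfy the stated requirements for the current set system. *)

theory Defs
  imports Main
begin

text \<open>Set systems are families \<open>F \<subseteq> Pow {1..n}\<close>; the support of \<open>F\<close> is written \<open>\<Union>F\<close>.\<close>

definition shatters :: "nat set set \<Rightarrow> nat set \<Rightarrow> bool" where
  "shatters F S \<longleftrightarrow> {X \<inter> S | X. X \<in> F} = Pow S"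

definition Sh :: "nat \<Rightarrow> nat set set \<Rightarrow> nat set set" where
  "Sh n F = {S. S \<subseteq> {1..n} \<and> shatters F S}"

definition extremal :: "nat \<Rightarrow> nat set set \<Rightarrow> bool" where
  "extremal n F \<longleftrightarrow> card (Sh n F) = card F"

text \<open>\<open>Sh n F\<close> is finite, and it contains the empty set as soon as \<open>F\<close> is nonempty.
  For \<open>F = {}\<close> the value is that of \<open>Max {}\<close>, which is unspecified.\<close>

definition dim_VC :: "nat \<Rightarrow> nat set set \<Rightarrow> nat" where
  "dim_VC n F = Max (card ` Sh n F)"

definition strongly_shatters :: "nat \<Rightarrow> nat set set \<Rightarrow> nat set \<Rightarrow> bool" where
  "strongly_shatters n F S \<longleftrightarrow> (\<exists>I. I \<subseteq> {1..n} - S \<and> {H \<union> I | H. H \<subseteq> S} \<subseteq> F)"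

definition st :: "nat \<Rightarrow> nat set set \<Rightarrow> nat set set" where
  "st n F = {S. S \<subseteq> {1..n} \<and> strongly_shatters n F S}"

definition step_A :: "nat \<Rightarrow> nat set set \<Rightarrow> nat set set \<Rightarrow> bool" where
  "step_A n F F' \<longleftrightarrow>
     (\<exists>\<alpha> W. \<alpha> \<in> {1..n} - \<Union>F \<and> W \<in> F \<and> F' = F \<union> {W \<union> {\<alpha>}})"

definition step_B :: "nat \<Rightarrow> nat set set \<Rightarrow> nat set set \<Rightarrow> bool" where
  "step_B n F F' \<longleftrightarrow>
     (\<exists>\<alpha> \<beta> P W Q. \<alpha> \<in> \<Union>F \<and> \<beta> \<in> \<Union>F \<and> \<alpha> \<noteq> \<beta> \<and> {\<alpha>, \<beta>} \<notin> st n F \<and>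
        P \<in> F \<and> W \<in> F \<and> Q \<in> F \<and> sym_diff Q W = {\<alpha>} \<and> sym_diff P W = {\<beta>} \<and>
        F' = F \<union> {sym_diff W {\<alpha>, \<beta>}})"

definition \<E> :: "nat \<Rightarrow> nat set set set" where
  "\<E> n = {F. (\<lambda>G G'. step_A n G G' \<or> step_B n G G')\<^sup>*\<^sup>* {{}} F}"

end

theory Submission
  imports Defs
begin

text \<open>A step adds at most one set to \<open>Sh n F\<close>, while \<open>card F \<le> card (Sh n F)\<close> always holds, so steps
  preserve extremality. Conversely, let \<open>G\<close> be a maximal member of \<open>\<E> n\<close> inside an extremal \<open>F\<close> of
  dimension at most 2. Extremal families are isometric in the cube and their links are extremal, so if
  \<open>G \<noteq> F\<close> some edge of \<open>F\<close> leaves \<open>G\<close>. If its direction does not occur in \<open>G\<close>, Step A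
  applies. Otherwise take a leaving edge and a parallel edge of \<open>G\<close> at minimal distance; the square of
  \<open>F\<close> at the latter edge towards the former then has exactly three vertices in \<open>G\<close>. As \<open>F\<close>
  shatters no 3-set, it has only one square in these two directions, so Step B applies.\<close>

section \<open>Shattering and strong shattering: elementary facts\<close>

lemma shatters_iff: "shatters F S \<longleftrightarrow> (\<forall>T\<subseteq>S. \<exists>X\<in>F. X \<inter> S = T)"
proof
  assume L: "shatters F S"
  show "\<forall>T\<subseteq>S. \<exists>X\<in>F. X \<inter> S = T"
  proof (intro allI impI)
    fix T assume "T \<subseteq> S"
    with L have "T \<in> {X \<inter> S | X. X \<in> F}" unfolding shatters_def by simp
    then show "\<exists>X\<in>F. X \<inter> S = T" by auto
  qed
next
  assume R: "\<forall>T\<subseteq>S. \<exists>X\<in>F. X \<inter> S = T"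
  have "T \<in> {X \<inter> S | X. X \<in> F}" if T: "T \<subseteq> S" for T
  proof -
    obtain X where "X \<in> F" "X \<inter> S = T" using R T by meson
    then show ?thesis by auto
  qed
  then show "shatters F S" unfolding shatters_def by auto
qed

lemma shatters_mono: "shatters F S \<Longrightarrow> F \<subseteq> G \<Longrightarrow> shatters G S"
  unfolding shatters_iff by (meson subsetD)

lemma finite_Sh [simp]: "finite (Sh n F)"
  unfolding Sh_def by (rule finite_subset[of _ "Pow {1..n}"]) auto

lemma Sh_mono: "F \<subseteq> G \<Longrightarrow> Sh n F \<subseteq> Sh n G"
  unfolding Sh_def using shatters_mono by blast

lemma mem_Sh_iff:
  assumes "F \<subseteq> Pow {1..n}"
  shows "S \<in> Sh n F \<longleftrightarrow> shatters F S"
proof -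
  have "S \<subseteq> {1..n}" if "shatters F S"
    using that assms unfolding shatters_iff by blast
  then show ?thesis unfolding Sh_def by blast
qed

lemma empty_mem_Sh: "F \<noteq> {} \<Longrightarrow> {} \<in> Sh n F"
  unfolding Sh_def shatters_iff by auto

lemma mem_st_iff:
  "S \<in> st n F \<longleftrightarrow>
    S \<subseteq> {1..n} \<and> (\<exists>I. I \<inter> S = {} \<and> I \<subseteq> {1..n} \<and> (\<forall>H\<subseteq>S. H \<union> I \<in> F))"
proof -
  have "I \<subseteq> {1..n} - S \<and> {H \<union> I | H. H \<subseteq> S} \<subseteq> F \<longleftrightarrow>
      I \<inter> S = {} \<and> I \<subseteq> {1..n} \<and> (\<forall>H\<subseteq>S. H \<union> I \<in> F)" for I by auto
  then show ?thesis unfolding st_def strongly_shatters_def by simp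
qed

lemma st_E:
  assumes "S \<in> st n F"
  obtains I where "I \<inter> S = {}" "\<forall>H\<subseteq>S. H \<union> I \<in> F"
  using assms unfolding mem_st_iff by metis

lemma finite_family: "F \<subseteq> Pow {1..n::nat} \<Longrightarrow> finite F"
  by (rule finite_subset[of _ "Pow {1..n}"]) auto

lemma finite_member: "F \<subseteq> Pow {1..n::nat} \<Longrightarrow> A \<in> F \<Longrightarrow> finite A"
  by (meson PowD finite_atLeastAtMost finite_subset subsetD)

section \<open>The inequality \<open>card F \<le> card (Sh n F)\<close>\<close>

text \<open>The members of a half agree at \<open>x\<close>, so no set containing \<open>x\<close>
  is shattered by it. A set shattered by both halves is counted twice on the left, and pays for it
  in \<open>Sh n F\<close> once as \<open>S\<close> and once as \<open>insert x S\<close>.\<close>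

lemma card_Sh_halves:
  assumes F: "F \<subseteq> Pow {1..n}"
  shows "card (Sh n {X\<in>F. x \<notin> X}) + card (Sh n {X\<in>F. x \<in> X}) \<le> card (Sh n F)"
proof -
  let ?A = "Sh n {X\<in>F. x \<notin> X}" and ?B = "Sh n {X\<in>F. x \<in> X}"
  have A: "x \<notin> S" if "S \<in> ?A" for S
    using that unfolding Sh_def shatters_iff by blast
  have B: "x \<notin> S" if "S \<in> ?B" for S
    using that unfolding Sh_def shatters_iff by blast
  have "inj_on (insert x) (?A \<inter> ?B)"
  proof (rule inj_onI)
    fix S T assume "S \<in> ?A \<inter> ?B" "T \<in> ?A \<inter> ?B" and eq: "insert x S = insert x T"
    then have "x \<notin> S" "x \<notin> T" using A by blast+
    with eq show "S = T" by (simp add: insert_ident)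
  qed
  then have card_Int: "card (?A \<inter> ?B) = card (insert x ` (?A \<inter> ?B))"
    by (rule card_image[symmetric])
  have "card ?A + card ?B = card (?A \<union> ?B) + card (?A \<inter> ?B)"
    by (rule card_Un_Int) simp_all
  also have "card (?A \<inter> ?B) = card (insert x ` (?A \<inter> ?B))" by (rule card_Int)
  also have "card (?A \<union> ?B) + \<dots> = card ((?A \<union> ?B) \<union> insert x ` (?A \<inter> ?B))"
  proof (rule card_Un_disjoint[symmetric])
    show "(?A \<union> ?B) \<inter> insert x ` (?A \<inter> ?B) = {}" using A B by blast
  qed simp_all
  also have "\<dots> \<le> card (Sh n F)"
  proof (intro card_mono Un_least)
    show "?A \<subseteq> Sh n F" "?B \<subseteq> Sh n F" by (rule Sh_mono, blast)+
    show "insert x ` (?A \<inter> ?B) \<subseteq> Sh n F"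
    proof
      fix S assume "S \<in> insert x ` (?A \<inter> ?B)"
      then obtain T where S: "S = insert x T" and T: "T \<in> ?A" "T \<in> ?B" by blast
      have "\<exists>X\<in>F. X \<inter> S = U" if "U \<subseteq> S" for U
      proof (cases "x \<in> U")
        case True
        have "U - {x} \<subseteq> T" using \<open>U \<subseteq> S\<close> S by blast
        then obtain X where "X \<in> {X\<in>F. x \<in> X}" "X \<inter> T = U - {x}"
          using T(2) unfolding Sh_def shatters_iff by blast
        with True S show ?thesis by (intro bexI[of _ X]) auto
      next
        case False
        then have "U \<subseteq> T" using \<open>U \<subseteq> S\<close> S by blast
        then obtain X where "X \<in> {X\<in>F. x \<notin> X}" "X \<inter> T = U"
          using T(1) unfolding Sh_def shatters_iff by blast
        with False S show ?thesis by (intro bexI[of _ X]) auto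
      qed
      then show "S \<in> Sh n F" unfolding mem_Sh_iff[OF F] shatters_iff by blast
    qed
  qed simp
  finally show ?thesis .
qed

lemma card_halves:
  assumes "finite F"
  shows "card F = card {X\<in>F. x \<notin> X} + card {X\<in>F. x \<in> X}"
proof -
  have "card F = card ({X\<in>F. x \<notin> X} \<union> {X\<in>F. x \<in> X})"
    by (rule arg_cong[of _ _ card]) blast
  also have "\<dots> = card {X\<in>F. x \<notin> X} + card {X\<in>F. x \<in> X}"
    using assms by (intro card_Un_disjoint) auto
  finally show ?thesis .
qed

text \<open>Pajor's inequality, by splitting at an element where two members differ. A family with a
  single member shatters at least the empty set.\<close>

lemma card_le_card_Sh:
  assumes "F \<subseteq> Pow {1..n}"
  shows "card F \<le> card (Sh n F)"
  using assms
proof (induction "card F" arbitrary: F rule: less_induct)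
  case less
  have fin: "finite F" using less.prems by (rule finite_family)
  show ?case
  proof (cases "\<exists>A\<in>F. \<exists>B\<in>F. A \<noteq> B")
    case True
    \<comment> \<open>Each half misses one of \<open>A\<close> and \<open>B\<close>, so both are
      strictly smaller.\<close>
    then obtain A B x where AB: "A \<in> F" "B \<in> F" "x \<in> A" "x \<notin> B" by blast
    let ?F0 = "{X\<in>F. x \<notin> X}" and ?F1 = "{X\<in>F. x \<in> X}"
    have "card ?F0 < card F" "card ?F1 < card F"
      using AB fin by (auto intro!: psubset_card_mono)
    moreover have "?F0 \<subseteq> Pow {1..n}" "?F1 \<subseteq> Pow {1..n}" using less.prems by blast+
    ultimately have "card ?F0 \<le> card (Sh n ?F0)" "card ?F1 \<le> card (Sh n ?F1)"
      by (simp_all only: less.hyps)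
    then show ?thesis
      using card_Sh_halves[OF less.prems, of x] card_halves[OF fin, of x] by linarith
  next
    case False
    show ?thesis
    proof (cases "F = {}")
      case nonempty: False
      with False have "card F = 1" by (metis card_1_singleton_iff is_singletonI' is_singleton_altdef)
      moreover have "card (Sh n F) > 0"
        using empty_mem_Sh[OF nonempty] by (auto simp: card_gt_0_iff)
      ultimately show ?thesis by simp
    qed simp
  qed
qed

section \<open>Extremality passes to halves and links\<close>

text \<open>The halves partition \<open>F\<close>, so a strict inequality in either half would
  survive in the sum and contradict \<open>card (Sh n F) = card F\<close>.\<close>

lemma extremal_halves:
  assumes F: "F \<subseteq> Pow {1..n}" and "extremal n F"
  shows "extremal n {X\<in>F. x \<notin> X}" "extremal n {X\<in>F. x \<in> X}"
proof -
  have "card {X\<in>F. x \<notin> X} \<le> card (Sh n {X\<in>F. x \<notin> X})"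
       "card {X\<in>F. x \<in> X} \<le> card (Sh n {X\<in>F. x \<in> X})"
    using F by (blast intro!: card_le_card_Sh)+
  with card_Sh_halves[OF F, of x] card_halves[OF finite_family[OF F], of x] assms(2)
  show "extremal n {X\<in>F. x \<notin> X}" "extremal n {X\<in>F. x \<in> X}"
    unfolding extremal_def by linarith+
qed

text \<open>The edges of \<open>F\<close> in direction \<open>x\<close>, each represented by its
  endpoint without \<open>x\<close>.\<close>

definition link :: "nat \<Rightarrow> nat set set \<Rightarrow> nat set set" where
  "link x F = {X. x \<notin> X \<and> X \<in> F \<and> insert x X \<in> F}"

lemma link_subset: "link x F \<subseteq> F"
  unfolding link_def by blast

text \<open>Deleting \<open>x\<close> from all members merges exactly the pairs counted by the link,
  so \<open>card F\<close> is the size of the projection plus that of the link. Sets shattered by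
  the projection, and sets shattered by the link with \<open>x\<close> added, are all shattered by
  \<open>F\<close> and never coincide. Extremality makes every estimate tight: the link is extremal,
  and a shattered set containing \<open>x\<close> must be of the second kind.\<close>

lemma extremal_link:
  assumes F: "F \<subseteq> Pow {1..n}" and ext: "extremal n F"
  shows "extremal n (link x F)"
    and "S \<in> Sh n F \<Longrightarrow> x \<in> S \<Longrightarrow> S - {x} \<in> Sh n (link x F)"
proof -
  let ?P = "(\<lambda>X. X - {x}) ` F"
  let ?F0 = "{X\<in>F. x \<notin> X}" and ?F1 = "(\<lambda>X. X - {x}) ` {X\<in>F. x \<in> X}"
  let ?A = "Sh n ?P" and ?B = "Sh n (link x F)"
  have fin: "finite F" using F by (rule finite_family)
  have P: "?P \<subseteq> Pow {1..n}" and L: "link x F \<subseteq> Pow {1..n}"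
    using F link_subset by blast+
  have xA: "x \<notin> S" if "S \<in> ?A" for S
    using that unfolding Sh_def shatters_iff by blast
  have xB: "x \<notin> S" if "S \<in> ?B" for S
    using that unfolding Sh_def shatters_iff link_def by blast
  have "(\<lambda>X. X - {x}) ` ?F0 = id ` ?F0" by (rule image_cong) auto
  moreover have "?P = (\<lambda>X. X - {x}) ` ?F0 \<union> ?F1" by blast
  ultimately have Un: "?P = ?F0 \<union> ?F1" by simp
  have Int: "link x F = ?F0 \<inter> ?F1"
    unfolding link_def
    by (auto simp: image_iff insert_absorb intro!: bexI[of _ "insert x _"])
  have "card ?F1 = card {X\<in>F. x \<in> X}"
    by (intro card_image inj_onI) (auto simp: set_eq_iff)
  then have cF: "card F = card ?P + card (link x F)"
    unfolding Un Int using fin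
    by (subst card_Un_Int[symmetric]) (auto simp: card_halves[of F x])
  have AF: "?A \<subseteq> Sh n F"
  proof
    fix S assume S: "S \<in> ?A"
    then have "shatters ?P S" unfolding Sh_def by blast
    have "\<exists>X\<in>F. X \<inter> S = T" if "T \<subseteq> S" for T
    proof -
      from that \<open>shatters ?P S\<close> obtain X where "X \<in> F" "(X - {x}) \<inter> S = T"
        unfolding shatters_iff by blast
      with xA[OF S] show ?thesis by (intro bexI[of _ X]) auto
    qed
    then show "S \<in> Sh n F" unfolding mem_Sh_iff[OF F] shatters_iff by blast
  qed
  have BF: "insert x ` ?B \<subseteq> Sh n F"
  proof
    fix S assume "S \<in> insert x ` ?B"
    then obtain T where S: "S = insert x T" and T: "T \<in> ?B" by blast
    have "\<exists>X\<in>F. X \<inter> S = U" if "U \<subseteq> S" for U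
    proof -
      have "U - {x} \<subseteq> T" using that S by blast
      with T obtain X where X: "X \<in> link x F" "X \<inter> T = U - {x}"
        unfolding Sh_def shatters_iff by blast
      show ?thesis
      proof (cases "x \<in> U")
        case True
        with X S show ?thesis unfolding link_def by (intro bexI[of _ "insert x X"]) auto
      next
        case False
        with X S show ?thesis unfolding link_def by (intro bexI[of _ X]) auto
      qed
    qed
    then show "S \<in> Sh n F" unfolding mem_Sh_iff[OF F] shatters_iff by blast
  qed
  have sub: "?A \<union> insert x ` ?B \<subseteq> Sh n F" using AF BF by blast
  have "card (insert x ` ?B) = card ?B"
    using xB by (intro card_image inj_onI) (metis insert_ident)
  then have cU: "card (?A \<union> insert x ` ?B) = card ?A + card ?B"
    using xA by (subst card_Un_disjoint) auto
  have le: "card ?P \<le> card ?A" "card (link x F) \<le> card ?B"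
    by (intro card_le_card_Sh P L)+
  have "card (?A \<union> insert x ` ?B) \<le> card (Sh n F)"
    by (intro card_mono sub) simp
  with cU le cF ext show "extremal n (link x F)"
    unfolding extremal_def by linarith
  have "card (Sh n F) \<le> card (?A \<union> insert x ` ?B)"
    using cU le cF ext unfolding extremal_def by linarith
  then have eq: "?A \<union> insert x ` ?B = Sh n F"
    by (intro card_seteq sub) simp_all
  assume "S \<in> Sh n F" "x \<in> S"
  with eq xA obtain T where "S = insert x T" "T \<in> ?B" by blast
  with xB show "S - {x} \<in> Sh n (link x F)" by simp
qed

text \<open>Induction on \<open>S\<close>: the link at \<open>x\<close> is extremal and shatters the
  rest of \<open>S\<close>, and a subcube of the link is the lower face of a subcube of
  \<open>F\<close> with \<open>x\<close> as an additional direction.\<close>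

lemma Sh_subset_st:
  assumes "F \<subseteq> Pow {1..n}" "extremal n F"
  shows "Sh n F \<subseteq> st n F"
proof
  fix S assume S: "S \<in> Sh n F"
  then have "finite S" unfolding Sh_def by (auto intro: finite_subset)
  from this S assms show "S \<in> st n F"
  proof (induction S arbitrary: F rule: finite_induct)
    case empty
    then obtain X where "X \<in> F" unfolding Sh_def shatters_iff by blast
    with empty.prems(2) show ?case by (auto simp: mem_st_iff)
  next
    case (insert x S)
    have L: "link x F \<subseteq> Pow {1..n}" using insert.prems link_subset by blast
    have "S \<in> Sh n (link x F)"
      using extremal_link(2)[OF insert.prems(2,3,1), of x] insert.hyps by simp
    with insert.IH L extremal_link(1)[OF insert.prems(2,3)] have "S \<in> st n (link x F)" by blast
    then obtain I where I: "I \<inter> S = {}" "I \<subseteq> {1..n}" "\<And>H. H \<subseteq> S \<Longrightarrow> H \<union> I \<in> link x F"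
      unfolding mem_st_iff by blast
    \<comment> \<open>The vertex with \<open>H = {}\<close> is \<open>I\<close> itself, and members
      of the link avoid \<open>x\<close>.\<close>
    have xI: "x \<notin> I" using I(3)[of "{}"] unfolding link_def by simp
    have "H \<union> I \<in> F" if "H \<subseteq> insert x S" for H
    proof -
      have *: "(H - {x}) \<union> I \<in> link x F" using that by (intro I(3)) blast
      show ?thesis
      proof (cases "x \<in> H")
        case True
        then have "H \<union> I = insert x ((H - {x}) \<union> I)" by blast
        with * show ?thesis unfolding link_def by simp
      next
        case False
        with * show ?thesis unfolding link_def by simp
      qed
    qed
    moreover have "insert x S \<subseteq> {1..n}" using insert.prems(1) unfolding Sh_def by blast
    ultimately show ?case
      using I(1,2) xI unfolding mem_st_iff by (intro conjI exI[of _ I]) auto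
  qed
qed

section \<open>Edges and shortest paths in extremal families\<close>

text \<open>Prescribing one element at a time, each restriction is a half of the previous
  family.\<close>

lemma extremal_interval:
  assumes "F \<subseteq> Pow {1..n}" "extremal n F" "finite L" "finite U"
  shows "extremal n {X\<in>F. L \<subseteq> X \<and> U \<inter> X = {}}"
proof -
  have "extremal n {X\<in>F. L \<subseteq> X}"
    using assms(3)
  proof (induction L rule: finite_induct)
    case empty
    then show ?case using assms by simp
  next
    case (insert x L)
    have "{X\<in>F. insert x L \<subseteq> X} = {X\<in>{X\<in>F. L \<subseteq> X}. x \<in> X}" by blast
    with extremal_halves(2)[OF _ insert.IH, of x] assms(1) show ?case by auto
  qed
  with assms(4) show ?thesis
  proof (induction U rule: finite_induct)
    case empty
    then show ?case by simp
  next
    case (insert x U)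
    have "{X\<in>F. L \<subseteq> X \<and> insert x U \<inter> X = {}} =
        {X\<in>{X\<in>F. L \<subseteq> X \<and> U \<inter> X = {}}. x \<notin> X}" by blast
    with extremal_halves(1)[OF _ insert.IH, of x] insert.prems assms(1) show ?case by auto
  qed
qed

text \<open>Inside the subcube spanned by \<open>A\<close> and \<open>B\<close> the family is still
  extremal and shatters \<open>{x}\<close>, hence contains an edge in direction \<open>x\<close>;
  \<open>C\<close> is its endpoint on the side of \<open>A\<close>.\<close>

lemma extremal_edge_between:
  assumes F: "F \<subseteq> Pow {1..n}" "extremal n F"
    and AB: "A \<in> F" "B \<in> F" and x: "x \<in> sym_diff A B"
  obtains C where "C \<in> F" "sym_diff C {x} \<in> F" "sym_diff A C \<subseteq> sym_diff A B - {x}"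
proof -
  \<comment> \<open>The smallest subcube containing both: common elements are forced, elements in
    neither are forbidden.\<close>
  let ?K = "{X\<in>F. A \<inter> B \<subseteq> X \<and> ({1..n} - (A \<union> B)) \<inter> X = {}}"
  have K: "?K \<subseteq> Pow {1..n}" using F by blast
  have "finite A" using finite_member[OF F(1) AB(1)] .
  then have ext: "extremal n ?K" using F by (intro extremal_interval) auto
  have "A \<in> ?K" "B \<in> ?K" using AB by auto
  then have "shatters ?K {x}"
    using x unfolding shatters_iff by (auto simp: subset_singleton_iff)
  then have "{x} \<in> st n ?K" using Sh_subset_st[OF K ext] mem_Sh_iff[OF K] by blast
  then obtain I where I0: "I \<inter> {x} = {}" "\<forall>H\<subseteq>{x}. H \<union> I \<in> ?K"
    by (rule st_E)
  then have "x \<notin> I" by simp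
  from I0(2)[rule_format, of "{}"] I0(2)[rule_format, of "{x}"]
  have I: "I \<in> ?K" "insert x I \<in> ?K" by simp_all
  have I1: "sym_diff I {x} = insert x I" "sym_diff (insert x I) {x} = I"
    using \<open>x \<notin> I\<close> by auto
  have K': "A \<inter> B \<subseteq> X \<and> X \<subseteq> A \<union> B" if "X \<in> ?K" for X using that K by blast
  show thesis
  proof (cases "x \<in> A")
    case True
    have "sym_diff A (insert x I) \<subseteq> sym_diff A B - {x}" using K'[OF I(2)] True by blast
    with that[of "insert x I"] I I1 show ?thesis by simp
  next
    case False
    have "sym_diff A I \<subseteq> sym_diff A B - {x}" using K'[OF I(1)] False \<open>x \<notin> I\<close> by blast
    with that[of I] I I1 show ?thesis by simp
  qed
qed

text \<open>The local form of isometry. An edge between \<open>A\<close> and \<open>B\<close> has an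
  endpoint \<open>C\<close> closer to \<open>A\<close> than \<open>B\<close> is; replacing
  \<open>B\<close> by \<open>C\<close> shrinks the distance until \<open>C = A\<close>, where the
  edge starts at \<open>A\<close>.\<close>

lemma extremal_step_towards:
  assumes F: "F \<subseteq> Pow {1..n}" "extremal n F"
    and "A \<in> F" "B \<in> F" "A \<noteq> B"
  shows "\<exists>x \<in> sym_diff A B. sym_diff A {x} \<in> F"
  using assms(3-)
proof (induction "card (sym_diff A B)" arbitrary: B rule: less_induct)
  case less
  then obtain x where x: "x \<in> sym_diff A B" by blast
  obtain C where C: "C \<in> F" "sym_diff C {x} \<in> F" "sym_diff A C \<subseteq> sym_diff A B - {x}"
    using extremal_edge_between[OF F less.prems(1,2) x] .
  show ?case
  proof (cases "A = C")
    case True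
    with C x show ?thesis by blast
  next
    case False
    have "finite (sym_diff A B)" using finite_member[OF F(1)] less.prems by simp
    then have "card (sym_diff A C) < card (sym_diff A B)"
      using C(3) x by (intro psubset_card_mono) blast+
    with less.hyps[OF _ less.prems(1) C(1) False] C(3) show ?thesis by blast
  qed
qed

section \<open>Families built by the steps are extremal of dimension at most 2\<close>

lemma dim_VC_le_iff:
  "F \<noteq> {} \<Longrightarrow> dim_VC n F \<le> d \<longleftrightarrow> (\<forall>S\<in>Sh n F. card S \<le> d)"
  unfolding dim_VC_def using empty_mem_Sh[of F n] by (subst Max_le_iff) auto

text \<open>The family gains one set and \<open>Sh\<close> at most one, while
  \<open>card_le_card_Sh\<close> keeps \<open>Sh\<close> from falling behind.\<close>

lemma extremal_insert:
  assumes G: "insert V F \<subseteq> Pow {1..n}" and "extremal n F"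
    and V: "V \<notin> F" and sub: "Sh n (insert V F) \<subseteq> insert S (Sh n F)"
  shows "extremal n (insert V F)"
proof -
  have "card (Sh n (insert V F)) \<le> card (insert S (Sh n F))"
    by (intro card_mono sub) simp
  also have "\<dots> \<le> Suc (card (Sh n F))" by (simp add: card_insert_if)
  also have "\<dots> = card (insert V F)"
    using assms finite_family[OF G] by (simp add: extremal_def)
  finally show ?thesis
    using card_le_card_Sh[OF G] unfolding extremal_def by linarith
qed

lemma Sh_step_A:
  assumes a: "a \<notin> \<Union>F" and W: "W \<in> F"
  shows "Sh n (insert (insert a W) F) \<subseteq> insert {a} (Sh n F)"
proof
  fix S assume "S \<in> Sh n (insert (insert a W) F)"
  then have S: "S \<subseteq> {1..n}" "\<And>T. T \<subseteq> S \<Longrightarrow> \<exists>X \<in> insert (insert a W) F. X \<inter> S = T"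
    unfolding Sh_def shatters_iff by auto
  show "S \<in> insert {a} (Sh n F)"
  proof (cases "a \<in> S")
    case True
    \<comment> \<open>Only the new set contains \<open>a\<close>, so \<open>S\<close> has a single
      trace containing \<open>a\<close>; both \<open>{a}\<close> and \<open>S\<close> must be that
      trace.\<close>
    have "T = insert a W \<inter> S" if "T \<subseteq> S" "a \<in> T" for T
      using S(2)[OF that(1)] a that(2) by blast
    from this[of "{a}"] this[of S] True have "S = {a}" by blast
    then show ?thesis by simp
  next
    case False
    have "\<exists>X\<in>F. X \<inter> S = T" if "T \<subseteq> S" for T
      using S(2)[OF that] False W by auto
    then show ?thesis using S(1) unfolding Sh_def shatters_iff by blast
  qed
qed

text \<open>A set missing \<open>a\<close> cannot tell the new set from \<open>P\<close>, one
  missing \<open>b\<close> cannot tell it from \<open>Q\<close>. If a strictly larger set than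
  \<open>{a, b}\<close> containing both were shattered, \<open>F\<close> alone would shatter
  \<open>{a, b}\<close>, which \<open>Sh_subset_st\<close> excludes.\<close>

lemma Sh_step_B:
  assumes F: "F \<subseteq> Pow {1..n}" "extremal n F"
    and ab: "{a, b} \<notin> st n F"
    and P: "P \<in> F" "sym_diff P W = {b}" and Q: "Q \<in> F" "sym_diff Q W = {a}"
  shows "Sh n (insert (sym_diff W {a, b}) F) \<subseteq> insert {a, b} (Sh n F)"
proof
  let ?V = "sym_diff W {a, b}"
  fix S assume "S \<in> Sh n (insert ?V F)"
  then have S: "S \<subseteq> {1..n}" "\<And>T. T \<subseteq> S \<Longrightarrow> \<exists>X \<in> insert ?V F. X \<inter> S = T"
    unfolding Sh_def shatters_iff by auto
  have PQ: "P = sym_diff W {b}" "Q = sym_diff W {a}" using P(2) Q(2) by blast+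
  show "S \<in> insert {a, b} (Sh n F)"
  proof (cases "a \<in> S \<and> b \<in> S")
    case False
    then have "?V \<inter> S = P \<inter> S \<or> ?V \<inter> S = Q \<inter> S"
      unfolding PQ by blast
    then have "\<exists>X\<in>F. X \<inter> S = T" if "T \<subseteq> S" for T
      using S(2)[OF that] P(1) Q(1) by auto
    then show ?thesis using S(1) unfolding Sh_def shatters_iff by blast
  next
    case True
    show ?thesis
    proof (cases "S = {a, b}")
      case False
      with True obtain c where c: "c \<in> S" "c \<noteq> a" "c \<noteq> b" by blast
      have "\<exists>X\<in>F. X \<inter> {a, b} = T" if T: "T \<subseteq> {a, b}" for T
      proof -
        \<comment> \<open>\<open>T\<close> has the two extensions \<open>T\<close> and \<open>insert c T\<close> in \<open>S\<close>, and \<open>?V\<close> can realise only one.\<close>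
        have "T \<subseteq> S" "insert c T \<subseteq> S" using T True c by auto
        then obtain X Y where "X \<in> insert ?V F" "X \<inter> S = T" "Y \<in> insert ?V F" "Y \<inter> S = insert c T"
          using S(2) by meson
        moreover have "c \<notin> T" using T c by blast
        ultimately have "(X \<in> F \<or> Y \<in> F) \<and> X \<inter> S = T \<and> Y \<inter> S = insert c T" by blast
        moreover have "Z \<inter> {a, b} = (Z \<inter> S) \<inter> {a, b}" for Z using True by blast
        moreover have "T \<inter> {a, b} = T" "insert c T \<inter> {a, b} = T" using T c by auto
        ultimately show ?thesis by metis
      qed
      then have "{a, b} \<in> Sh n F" unfolding mem_Sh_iff[OF F(1)] shatters_iff by blast
      with ab Sh_subset_st[OF F] show ?thesis by blast
    qed simp
  qed
qed

text \<open>Translates a square seen from \<open>W\<close> into the form used by strong shattering,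
  with \<open>I = W - {a, b}\<close>.\<close>

lemma square_vertex:
  assumes "H \<subseteq> {a, b}"
    and W: "W \<in> F" "sym_diff W {a} \<in> F" "sym_diff W {b} \<in> F" "sym_diff W {a, b} \<in> F"
  shows "H \<union> (W - {a, b}) \<in> F"
proof -
  \<comment> \<open>\<open>K\<close> collects the directions in which the target vertex differs from
    \<open>W\<close>.\<close>
  define K where "K = sym_diff H (W \<inter> {a, b})"
  have "H \<union> (W - {a, b}) = sym_diff W K" using assms(1) unfolding K_def by blast
  moreover have "K \<in> Pow {a, b}" using assms(1) unfolding K_def by blast
  then have "K = {} \<or> K = {a} \<or> K = {b} \<or> K = {a, b}" unfolding Pow_insert by auto
  moreover have "sym_diff W {} = W" by simp
  ultimately show ?thesis using W by metis
qed

lemma square_in_st: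
  assumes F: "F \<subseteq> Pow {1..n}"
    and "W \<in> F" "sym_diff W {a} \<in> F" "sym_diff W {b} \<in> F" "sym_diff W {a, b} \<in> F"
  shows "{a, b} \<in> st n F"
proof -
  have *: "H \<union> (W - {a, b}) \<in> F" if "H \<subseteq> {a, b}" for H
    using that assms(2-) by (rule square_vertex)
  moreover have "{a, b} \<subseteq> {1..n}" using *[of "{a, b}"] F by blast
  ultimately show ?thesis
    using F \<open>W \<in> F\<close> unfolding mem_st_iff by (intro conjI exI[of _ "W - {a, b}"]) auto
qed

text \<open>Extremality belongs to the invariant because \<open>Sh_step_B\<close> draws on it for
  the current family.\<close>

lemma \<E>_sound:
  assumes "F \<in> \<E> n"
  shows "F \<subseteq> Pow {1..n} \<and> extremal n F \<and> {} \<in> F \<and> (\<forall>S\<in>Sh n F. card S \<le> 2)"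
  using assms unfolding \<E>_def mem_Collect_eq
proof (induction rule: rtranclp_induct)
  case base
  have "Sh n {{}} = {{}}" unfolding Sh_def shatters_iff by auto
  then show ?case by (simp add: extremal_def)
next
  case (step F F')
  from step.IH have F: "F \<subseteq> Pow {1..n}" and ext: "extremal n F" and "{} \<in> F"
    and dim: "\<forall>S\<in>Sh n F. card S \<le> 2" by auto
  \<comment> \<open>\<open>V\<close> is the added set and \<open>S\<close> the only set that can
    become shattered: a singleton for Step A, a pair for Step B.\<close>
  have *: ?case if "F' = insert V F" "V \<subseteq> {1..n}" "V \<notin> F" "card S \<le> 2"
    "Sh n (insert V F) \<subseteq> insert S (Sh n F)" for V S
    using that F \<open>{} \<in> F\<close> dim extremal_insert[OF _ ext that(3,5)] by auto
  from step.hyps(2) show ?case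
  proof
    assume "step_A n F F'"
    then obtain a W where a: "a \<in> {1..n} - \<Union>F" and W: "W \<in> F" and "F' = insert (insert a W) F"
      unfolding step_A_def by auto
    moreover have "insert a W \<notin> F" using a by blast
    moreover have "insert a W \<subseteq> {1..n}" using a W F by blast
    moreover have "Sh n (insert (insert a W) F) \<subseteq> insert {a} (Sh n F)"
      using a W by (intro Sh_step_A) auto
    ultimately show ?case by (intro *[of "insert a W" "{a}"]) auto
  next
    assume "step_B n F F'"
    then obtain a b P W Q where ab: "a \<in> \<Union>F" "b \<in> \<Union>F" "a \<noteq> b" "{a, b} \<notin> st n F"
      and PWQ: "P \<in> F" "W \<in> F" "Q \<in> F" "sym_diff Q W = {a}" "sym_diff P W = {b}"
      and "F' = F \<union> {sym_diff W {a, b}}"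
      unfolding step_B_def by blast
    then have F': "F' = insert (sym_diff W {a, b}) F" by simp
    have "P = sym_diff W {b}" "Q = sym_diff W {a}" using PWQ(4,5) by blast+
    \<comment> \<open>A fourth vertex in \<open>F\<close> would complete the square and put
      \<open>{a, b}\<close> into \<open>st n F\<close>.\<close>
    then have "sym_diff W {a, b} \<notin> F"
      using square_in_st[OF F PWQ(2)] PWQ(1,3) ab(4) by blast
    moreover have "sym_diff W {a, b} \<subseteq> {1..n}" using ab PWQ F by blast
    moreover have "Sh n (insert (sym_diff W {a, b}) F) \<subseteq> insert {a, b} (Sh n F)"
      by (rule Sh_step_B[OF F ext ab(4) PWQ(1,5,3,4)])
    ultimately show ?case using F' ab(3) by (intro *[of "sym_diff W {a, b}" "{a, b}"]) auto
  qed
qed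

section \<open>Squares, parallel edges and the search for the next step\<close>

text \<open>The square over \<open>I\<close> supplies the traces containing \<open>c\<close>, the
  square over \<open>J\<close> those without it.\<close>

lemma shatters_two_squares:
  assumes I: "\<And>H. H \<subseteq> {a, b} \<Longrightarrow> H \<union> I \<in> F" and J: "\<And>H. H \<subseteq> {a, b} \<Longrightarrow> H \<union> J \<in> F"
    and c: "c \<in> I" "c \<notin> J" and "I \<inter> {a, b} = {}" "J \<inter> {a, b} = {}"
  shows "shatters F {a, b, c}"
  unfolding shatters_iff
proof (intro allI impI)
  fix T assume T: "T \<subseteq> {a, b, c}"
  show "\<exists>X\<in>F. X \<inter> {a, b, c} = T"
  proof (cases "c \<in> T")
    case True
    with c(1) T assms(5) have "((T \<inter> {a, b}) \<union> I) \<inter> {a, b, c} = T" by blast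
    with I[of "T \<inter> {a, b}"] show ?thesis by blast
  next
    case False
    with c(2) T assms(6) have "((T \<inter> {a, b}) \<union> J) \<inter> {a, b, c} = T" by blast
    with J[of "T \<inter> {a, b}"] show ?thesis by blast
  qed
qed

text \<open>Supplies the Step B condition for \<open>G\<close>. A square of \<open>G\<close> in
  directions \<open>a\<close>, \<open>b\<close> would differ from the one at \<open>W\<close>, whose
  corner opposite \<open>W\<close> is outside \<open>G\<close>; both lie in \<open>F\<close>, and an
  element \<open>c\<close> separating them yields a shattered 3-set.\<close>

lemma square_unique:
  assumes F: "F \<subseteq> Pow {1..n}" and dim: "\<forall>S\<in>Sh n F. card S \<le> 2" and "G \<subseteq> F" and "a \<noteq> b"
    and W: "W \<in> F" "sym_diff W {a} \<in> F" "sym_diff W {b} \<in> F" "sym_diff W {a, b} \<in> F"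
    and out: "sym_diff W {a, b} \<notin> G"
  shows "{a, b} \<notin> st n G"
proof
  assume "{a, b} \<in> st n G"
  then obtain I where I: "I \<inter> {a, b} = {}" "\<And>H. H \<subseteq> {a, b} \<Longrightarrow> H \<union> I \<in> G"
    by (rule st_E) blast
  let ?J = "W - {a, b}"
  have J: "H \<union> ?J \<in> F" if "H \<subseteq> {a, b}" for H
    using that W by (rule square_vertex)
  have "sym_diff W {a, b} = ({a, b} - W) \<union> ?J" by blast
  with out I(2)[of "{a, b} - W"] have "I \<noteq> ?J" by auto
  then obtain c where c: "c \<in> I \<and> c \<notin> ?J \<or> c \<in> ?J \<and> c \<notin> I" by blast
  then have "shatters F {a, b, c}"
  proof
    assume "c \<in> I \<and> c \<notin> ?J"
    then show ?thesis
      using I J \<open>G \<subseteq> F\<close> by (intro shatters_two_squares[of a b I F ?J c]) auto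
  next
    assume "c \<in> ?J \<and> c \<notin> I"
    then show ?thesis
      using I J \<open>G \<subseteq> F\<close> by (intro shatters_two_squares[of a b ?J F I c]) auto
  qed
  then have "card {a, b, c} \<le> 2" using dim mem_Sh_iff[OF F] by blast
  moreover have "c \<noteq> a" "c \<noteq> b" using c I(1) by auto
  ultimately show False using \<open>a \<noteq> b\<close> by simp
qed

text \<open>Edges in direction \<open>a\<close> correspond to members of \<open>link a F\<close>,
  which is extremal; one step there from the edge at \<open>C\<close> towards the edge at
  \<open>W\<close> crosses a square of \<open>F\<close>.\<close>

lemma parallel_edge_step:
  assumes F: "F \<subseteq> Pow {1..n}" "extremal n F"
    and "C \<in> F" "sym_diff C {a} \<in> F" "W \<in> F" "sym_diff W {a} \<in> F"
    and "a \<notin> sym_diff C W" "C \<noteq> W"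
  obtains b where "b \<in> sym_diff C W" "sym_diff C {b} \<in> F" "sym_diff C {a, b} \<in> F"
proof -
  have mem: "X - {a} \<in> link a F" if "X \<in> F" "sym_diff X {a} \<in> F" for X
    using that unfolding link_def by (cases "a \<in> X") (auto simp: insert_absorb Un_commute)
  have "link a F \<subseteq> Pow {1..n}" using F link_subset by blast
  moreover have "C - {a} \<noteq> W - {a}" using assms(7,8) by blast
  ultimately obtain b where b: "b \<in> sym_diff (C - {a}) (W - {a})"
      "sym_diff (C - {a}) {b} \<in> link a F"
    using extremal_step_towards[OF _ extremal_link(1)[OF F], of a "C - {a}" "W - {a}"]
      mem assms(3-6) by blast
  then have "a \<noteq> b" by blast
  \<comment> \<open>Compared as unordered pairs, since \<open>a \<in> C\<close> decides which of the
    two endpoints lacks \<open>a\<close>.\<close>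
  then have "{sym_diff C {b}, sym_diff C {a, b}} =
      {sym_diff (C - {a}) {b}, insert a (sym_diff (C - {a}) {b})}"
    by (cases "a \<in> C"; cases "b \<in> C") (auto simp: doubleton_eq_iff)
  with b(2) have "{sym_diff C {b}, sym_diff C {a, b}} \<subseteq> F" unfolding link_def by simp
  with that[of b] b(1) show thesis by auto
qed

lemma step_BI:
  "\<lbrakk>a \<in> \<Union>F; b \<in> \<Union>F; a \<noteq> b; {a, b} \<notin> st n F; P \<in> F; W \<in> F; Q \<in> F;
    sym_diff Q W = {a}; sym_diff P W = {b}\<rbrakk> \<Longrightarrow> step_B n F (insert (sym_diff W {a, b}) F)"
  unfolding step_B_def
  by (rule exI[of _ a], rule exI[of _ b], rule exI[of _ P], rule exI[of _ W], rule exI[of _ Q]) simp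

text \<open>The induction is on the distance between the leaving edge and the edge of \<open>G\<close> parallel to it. If the
  vertex \<open>sym_diff C {b}\<close> of the square at \<open>C\<close> is not in \<open>G\<close>, the edge from \<open>C\<close> to it is itself a
  leaving edge, with a closer parallel edge found between \<open>C\<close> and \<open>W\<close>.\<close>

lemma step_B_exists:
  assumes F: "F \<subseteq> Pow {1..n}" "extremal n F" "\<forall>S\<in>Sh n F. card S \<le> 2"
    and G: "G \<subseteq> F" "extremal n G"
    and W: "W \<in> G" "sym_diff W {a} \<in> F - G"
    and C: "C \<in> G" "sym_diff C {a} \<in> G" "a \<notin> sym_diff C W"
  shows "\<exists>V\<in>F - G. step_B n G (insert V G)"
  using W C
proof (induction "card (sym_diff C W)" arbitrary: W C a rule: less_induct)
  case less
  have GF: "X \<in> F" if "X \<in> G" for X using that G by blast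
  have Gn: "G \<subseteq> Pow {1..n}" using F G by blast
  have fin: "finite (sym_diff C W)" using finite_member[OF Gn] less.prems by simp
  have "C \<noteq> W" using less.prems by blast
  then obtain b where b: "b \<in> sym_diff C W" "sym_diff C {b} \<in> F" "sym_diff C {a, b} \<in> F"
    using parallel_edge_step[OF F(1,2), of C a W] less.prems GF by blast
  have "a \<noteq> b" using less.prems(5) b(1) by blast
  have ba: "sym_diff (sym_diff C {b}) {a} = sym_diff C {a, b}"
    using \<open>a \<noteq> b\<close> by blast
  show ?case
  proof (cases "sym_diff C {b} \<in> G")
    case bG: True
    show ?thesis
    proof (cases "sym_diff C {a, b} \<in> G")
      case True
      \<comment> \<open>The whole square lies in \<open>G\<close>, so its side opposite the edge at
        \<open>C\<close> is a parallel edge one step closer to \<open>W\<close>.\<close>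
      have "card (sym_diff (sym_diff C {b}) W) < card (sym_diff C W)"
        using fin b(1) by (intro psubset_card_mono) blast+
      moreover have "a \<notin> sym_diff (sym_diff C {b}) W" using less.prems(5) \<open>a \<noteq> b\<close> by blast
      ultimately show ?thesis
        using less.hyps[of "sym_diff C {b}" W a] less.prems(1,2) bG True ba by simp
    next
      case False
      \<comment> \<open>Exactly the corner opposite \<open>C\<close> is missing, so Step B applies
        with \<open>C\<close> as its middle vertex.\<close>
      then have "{a, b} \<notin> st n G"
        using square_unique[OF F(1,3) G(1) \<open>a \<noteq> b\<close>, of C] less.prems(3,4) b(2,3) GF by blast
      moreover have "a \<in> \<Union>G" "b \<in> \<Union>G"
        using less.prems(3,4) bG by blast+
      moreover have "sym_diff (sym_diff C {a}) C = {a}" "sym_diff (sym_diff C {b}) C = {b}"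
        by blast+
      ultimately have "step_B n G (insert (sym_diff C {a, b}) G)"
        using \<open>a \<noteq> b\<close> less.prems(3,4) bG by (intro step_BI)
      with False b(3) show ?thesis by blast
    qed
  next
    case False
    obtain D where D: "D \<in> G" "sym_diff D {b} \<in> G" "sym_diff C D \<subseteq> sym_diff C W - {b}"
      using extremal_edge_between[OF Gn G(2) less.prems(3,1) b(1)] .
    have "card (sym_diff D C) < card (sym_diff C W)"
      using fin b(1) D(3) by (intro psubset_card_mono) blast+
    moreover have "b \<notin> sym_diff D C" using D(3) by blast
    ultimately show ?thesis
      using less.hyps[of D C b] less.prems(3) D b(2) False by blast
  qed
qed

text \<open>A leaving edge is found below a smallest member of \<open>F - G\<close>: a step from it
  towards \<open>{}\<close> deletes an element \<open>a\<close>, and minimality puts the result into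
  \<open>G\<close>. Whether \<open>a\<close> is already in the support of \<open>G\<close> decides
  between the two steps.\<close>

lemma step_exists:
  assumes F: "F \<subseteq> Pow {1..n}" "extremal n F" "\<forall>S\<in>Sh n F. card S \<le> 2"
    and G: "G \<subset> F" "extremal n G" "{} \<in> G"
  shows "\<exists>V\<in>F - G. step_A n G (insert V G) \<or> step_B n G (insert V G)"
proof -
  obtain V where V: "V \<in> F - G" and min: "\<And>X. X \<in> F - G \<Longrightarrow> card V \<le> card X"
    using G(1) ex_has_least_nat[of "\<lambda>X. X \<in> F - G" _ card] by blast
  have "V \<noteq> {}" using V G(3) by blast
  then obtain a where "a \<in> sym_diff V {}" and a: "sym_diff V {a} \<in> F"
    using extremal_step_towards[OF F(1,2), of V "{}"] V G by blast
  then have "a \<in> V" by simp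
  then have Va: "sym_diff V {a} = V - {a}" by blast
  have "finite V" using V finite_member[OF F(1)] by blast
  then have "card (V - {a}) < card V" using \<open>a \<in> V\<close> by (rule card_Diff1_less)
  with min[of "V - {a}"] a Va have W: "V - {a} \<in> G" by force
  show ?thesis
  proof (cases "a \<in> \<Union>G")
    case False
    moreover have "a \<in> {1..n}" using \<open>a \<in> V\<close> V F(1) by blast
    moreover have "insert V G = G \<union> {(V - {a}) \<union> {a}}" using \<open>a \<in> V\<close> by (simp add: insert_absorb)
    ultimately have "step_A n G (insert V G)"
      unfolding step_A_def using W by blast
    with V show ?thesis by blast
  next
    case True
    then obtain B where "B \<in> G" "a \<in> B" by blast
    then have "a \<in> sym_diff {} B" by simp
    \<comment> \<open>This edge of \<open>G\<close> has direction \<open>a\<close>; both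
      \<open>C\<close> and \<open>V - {a}\<close> avoid \<open>a\<close>, as
      \<open>step_B_exists\<close> demands of parallel edges.\<close>
    then obtain C where C: "C \<in> G" "sym_diff C {a} \<in> G" "sym_diff {} C \<subseteq> sym_diff {} B - {a}"
      using extremal_edge_between[OF _ G(2,3) \<open>B \<in> G\<close>] F G by blast
    have "sym_diff (V - {a}) {a} = V" using \<open>a \<in> V\<close> by blast
    then have "\<exists>V\<in>F - G. step_B n G (insert V G)"
      using step_B_exists[OF F _ G(2) W _ C(1,2)] C(3) V G(1) by auto
    then show ?thesis by blast
  qed
qed

lemma \<E>_complete:
  assumes F: "F \<subseteq> Pow {1..n}" "extremal n F" "\<forall>S\<in>Sh n F. card S \<le> 2" and "{} \<in> F"
  shows "F \<in> \<E> n"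
proof -
  have "finite F" using F(1) by (rule finite_family)
  have "{{}} \<in> \<E> n" unfolding \<E>_def by simp
  with \<open>{} \<in> F\<close> have ne: "{G \<in> \<E> n. G \<subseteq> F} \<noteq> {}" by blast
  have fin: "finite {G \<in> \<E> n. G \<subseteq> F}"
    using \<open>finite F\<close> by simp
  from finite_has_maximal[OF fin ne] obtain G where "G \<in> {G \<in> \<E> n. G \<subseteq> F}"
    and max: "\<forall>G'\<in>{G \<in> \<E> n. G \<subseteq> F}. G \<subseteq> G' \<longrightarrow> G = G'" by (rule bexE)
  then have G: "G \<in> \<E> n" "G \<subseteq> F" by simp_all
  have "G = F"
  proof (rule ccontr)
    assume "G \<noteq> F"
    then obtain V where V: "V \<in> F - G" and s: "step_A n G (insert V G) \<or> step_B n G (insert V G)"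
      using step_exists[OF F, of G] \<E>_sound[OF G(1)] G(2) by blast
    have "insert V G \<in> \<E> n"
      using G(1) s unfolding \<E>_def by (auto intro: rtranclp.rtrancl_into_rtrancl)
    then have "G = insert V G" using max V G(2) by blast
    with V show False by blast
  qed
  with G show ?thesis by simp
qed

theorem theorem4p1:
  fixes n :: nat and F :: "nat set set"
  assumes "n \<ge> 1" and "F \<subseteq> Pow {1..n}"
  shows "extremal n F \<and> dim_VC n F \<le> 2 \<and> {} \<in> F \<longleftrightarrow> F \<in> \<E> n"
  \<comment> \<open>Both sides give \<open>{} \<in> F\<close>, the right one by soundness, so
    \<open>dim_VC_le_iff\<close> meets a nonempty family.\<close>
  using \<E>_complete[OF assms(2)] \<E>_sound[of F n] dim_VC_le_iff[of F n 2] by blast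

end
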